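(* Let $L$ and $s$ be positive integers and let $V \subset \{s+1, \ldots, L+s\}$ with $|V| \geq 2$. Then for all integers $N \geq 2(L+s)^7 + (L+s)^5$, \[ |\{\pi \in I_{L,s,V} : |\pi| = N \}| \leq |\{\pi \in D_{L,s} : |\pi| = N\}|. \]
   Context: For a partition $\pi$, $|\pi|$ denotes the sum of its parts. $I_{L,s,V}$ is the set of integer partitions whose smallest part is $s$, all of whose parts are $\leq L+s$, and in which no element of $V$ appears as a part. $D_{L,s}$ is the set of nonempty integer partitions all of whose parts lie in $\{s+1, \ldots, L+s\}$. *)

theory Defs
  imports "HOL-Library.Multiset"
begin

text \<open>An integer partition is the finite multiset of its parts, which are positive;
  its size is \<^const>\<open>sum_mset\<close>.\<close>

definition partitions :: "nat multiset set" where
  "partitions = {p. \<forall>i\<in>#p. 0 < i}"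

text \<open>Having a smallest part includes being nonempty; this is stated explicitly because
  \<^const>\<open>Min\<close> is unspecified on the empty set.\<close>

definition I_parts :: "nat \<Rightarrow> nat \<Rightarrow> nat set \<Rightarrow> nat multiset set" where
  "I_parts L s V = {p \<in> partitions. p \<noteq> {#} \<and> Min (set_mset p) = s \<and>
     (\<forall>i\<in>#p. i \<le> L + s) \<and> (\<forall>v\<in>V. v \<notin># p)}"

definition D_parts :: "nat \<Rightarrow> nat \<Rightarrow> nat multiset set" where
  "D_parts L s = {p \<in> partitions. p \<noteq> {#} \<and> set_mset p \<subseteq> {s + 1..L + s}}"

end

theory Submission
  imports Defs
begin

text \<open>Let \<open>a < b\<close> be two elements of \<open>V\<close> and \<open>n = L + s\<close>. From a partition in
  \<^const>\<open>I_parts\<close>, remove all \<open>j\<close> copies of \<open>s\<close> and, if \<open>j * s < 2 * n\<^sup>2\<close>, also all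
  copies of a part \<open>i\<close> contributing a large share of the sum. The removed total \<open>w\<close> is
  refilled as \<open>x\<close> copies of \<open>a\<close>, \<open>y\<close> copies of \<open>b\<close> and \<open>z < a\<close> copies of \<open>a + 1\<close>, where
  \<open>y div a\<close> encodes which parts were removed, \<open>y\<close> is congruent to \<open>w\<close> modulo \<open>a\<close>, and \<open>z\<close>
  is a function of \<open>y\<close>. Since \<open>a\<close> and \<open>b\<close> are not parts of the given partition, \<open>x\<close>
  and \<open>y\<close>, hence also \<open>w\<close> and the given partition, can be read off from the result.\<close>

text \<open>The number of copies of \<open>a + 1\<close> is the residue of \<open>y * (1 - b)\<close> modulo \<open>a\<close>, written without
  subtraction below zero; it vanishes if \<open>b = a + 1\<close>, so \<open>y\<close> is the multiplicity of \<open>b\<close>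
  in every case.\<close>

definition refill :: "nat \<Rightarrow> nat \<Rightarrow> nat \<Rightarrow> nat \<Rightarrow> nat multiset" where
  "refill a b x y = replicate_mset x a + replicate_mset y b
     + replicate_mset (y * ((a - 1) * (b - 1)) mod a) (a + 1)"

text \<open>Code \<open>0\<close> stands for removing only copies of \<open>s\<close>, code \<open>i + (n + 1) * j + 1\<close> with
  \<open>i \<le> n\<close> for removing \<open>j\<close> copies of \<open>s\<close> and otherwise copies of \<open>i\<close>; \<open>w\<close> is the total removed.\<close>

definition removed :: "nat \<Rightarrow> nat \<Rightarrow> nat \<Rightarrow> nat \<Rightarrow> nat multiset" where
  "removed s n e w = (if e = 0 then replicate_mset (w div s) s
     else let i = (e - 1) mod (n + 1); j = (e - 1) div (n + 1)
          in replicate_mset j s + replicate_mset ((w - j * s) div i) i)"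

text \<open>A relation, so that \<open>x\<close> and \<open>y\<close> need not be chosen
  canonically. \<open>R\<close> is computed from \<open>x\<close> and \<open>y\<close> alone, which
  makes it recoverable from \<open>q\<close>.\<close>

definition exchanged :: "nat \<Rightarrow> nat \<Rightarrow> nat \<Rightarrow> nat \<Rightarrow> nat multiset \<Rightarrow> nat multiset \<Rightarrow> bool" where
  "exchanged s n a b p q \<longleftrightarrow> (\<exists>x y. let R = removed s n (y div a) (sum_mset (refill a b x y))
     in R \<subseteq># p \<and> q = p - R + refill a b x y)"

lemma count_refill:
  assumes "0 < a" "a < b"
  shows "count (refill a b x y) a = x" "count (refill a b x y) b = y"
proof -
  show "count (refill a b x y) a = x"
    using assms by (simp add: refill_def)
  have "y * ((a - 1) * a) mod a = 0"
    by (simp flip: mult.assoc)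
  then show "count (refill a b x y) b = y"
    using assms by (auto simp: refill_def)
qed

lemma exchanged_inj:
  assumes "0 < a" "a < b" "a \<notin># p" "b \<notin># p" "a \<notin># p'" "b \<notin># p'"
    and "exchanged s n a b p q" "exchanged s n a b p' q"
  shows "p = p'"
proof -
  obtain x y where 1: "removed s n (y div a) (sum_mset (refill a b x y)) \<subseteq># p"
    "q = p - removed s n (y div a) (sum_mset (refill a b x y)) + refill a b x y"
    using assms by (auto simp: exchanged_def Let_def)
  obtain x' y' where 2: "removed s n (y' div a) (sum_mset (refill a b x' y')) \<subseteq># p'"
    "q = p' - removed s n (y' div a) (sum_mset (refill a b x' y')) + refill a b x' y'"
    using assms by (auto simp: exchanged_def Let_def)
  have "count q a = x" "count q b = y"
    using assms 1(2) by (simp_all add: count_refill not_in_iff)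
  moreover have "count q a = x'" "count q b = y'"
    using assms 2(2) by (simp_all add: count_refill not_in_iff)
  ultimately show ?thesis
    using 1 2 by (metis add_right_cancel subset_mset.diff_add)
qed

text \<open>The code \<open>e\<close> confines \<open>y\<close> to \<open>a\<close> consecutive
  numbers starting at \<open>a * e\<close>, exactly one of which is congruent to \<open>w\<close>
  modulo \<open>a\<close>. The lower bound on \<open>w\<close> leaves a nonnegative amount for the
  copies of \<open>a\<close>.\<close>

lemma refill_exists:
  fixes a b e w :: nat
  assumes "0 < a" "a < b" "(e + 1) * a * b + a * (a + 1) \<le> w"
  obtains x y where "y div a = e" "sum_mset (refill a b x y) = w"
proof -
  define y where "y = w mod a + a * e"
  define z where "z = y * ((a - 1) * (b - 1)) mod a"
  have yd: "y div a = e"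
    using assms by (simp add: y_def)
  have "w mod a < a" using assms by simp
  then have "y \<le> (e + 1) * a" by (simp add: y_def algebra_simps)
  then have "y * b \<le> (e + 1) * a * b" by (rule mult_right_mono) simp
  moreover have "z < a" using assms by (simp add: z_def)
  then have "z * (a + 1) \<le> a * (a + 1)" by (intro mult_right_mono) auto
  ultimately have le: "y * b + z * (a + 1) \<le> w" using assms(3) by linarith
  \<comment> \<open>Modulo \<open>a\<close>, the \<open>z\<close> copies of \<open>a + 1\<close> add
    \<open>y * (1 - b)\<close> to \<open>y * b\<close>. This gives \<open>y\<close>, hence
    \<open>w\<close>.\<close>
  have key: "y * b + y * ((a - 1) * (b - 1)) = y + a * (y * (b - 1))"
  proof -
    obtain a' b' where "a = Suc a'" "b = Suc b'"
      using assms by (metis less_imp_Suc_add add_0)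
    then show ?thesis by (simp add: algebra_simps)
  qed
  have "(y * b + z * (a + 1)) mod a = (y * b + z) mod a"
    by (metis add.assoc distrib_left mod_mult_self2 mult.commute mult.right_neutral add.commute)
  also have "\<dots> = (y * b + y * ((a - 1) * (b - 1))) mod a"
    by (simp add: z_def mod_add_right_eq)
  also have "\<dots> = y mod a" by (simp only: key mod_mult_self2)
  also have "\<dots> = w mod a" by (simp add: y_def)
  finally have "a dvd w - (y * b + z * (a + 1))"
    using le by (metis mod_eq_dvd_iff_nat)
  then obtain x where "w - (y * b + z * (a + 1)) = a * x" by (elim dvdE)
  with le have "w = x * a + y * b + z * (a + 1)" by (simp add: algebra_simps)
  then have "sum_mset (refill a b x y) = w"
    by (simp add: refill_def z_def)
  with yd show ?thesis by (rule that)
qed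

lemma sum_mset_eq_sum_count:
  fixes p :: "nat multiset"
  assumes "finite A" "set_mset p \<subseteq> A"
  shows "sum_mset p = (\<Sum>i\<in>A. count p i * i)"
  using assms(2)
proof (induction p)
  case (add k p)
  have "(\<Sum>i\<in>A. count (add_mset k p) i * i) = (\<Sum>i\<in>A. count p i * i + (if i = k then k else 0))"
    by (intro sum.cong) auto
  also have "\<dots> = (\<Sum>i\<in>A. count p i * i) + k"
    using add.prems assms(1) by (simp add: sum.distrib)
  finally show ?case using add by simp
qed simp

text \<open>Pigeonhole: if the copies of \<open>s\<close> contribute less than
  \<open>2 * n ^ 2\<close>, the other part sizes, at most \<open>n\<close> of them, share more than
  \<open>2 * n ^ 7\<close>, so one of them contributes at least \<open>2 * n ^ 6\<close>.\<close>

lemma removed_exists: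
  fixes s n a b N :: nat
  assumes "0 < s" "s < a" "a < b" "b \<le> n" "2 * n ^ 7 + n ^ 5 \<le> N"
    and "set_mset p \<subseteq> {s..n}" "sum_mset p = N"
  obtains e w where "removed s n e w \<subseteq># p" "count (removed s n e w) s = count p s"
    "sum_mset (removed s n e w) = w" "(e + 1) * a * b + a * (a + 1) \<le> w"
proof -
  define j where "j = count p s"
  have n: "3 \<le> n" using assms by linarith
  have a: "a + 1 \<le> n" using assms by linarith
  have aa: "a * (a + 1) \<le> n * n" using a by (intro mult_mono) auto
  show ?thesis
  proof (cases "2 * n\<^sup>2 \<le> j * s")
    \<comment> \<open>Code \<open>0\<close> needs only \<open>a * b + a * (a + 1)\<close>, which is
      at most \<open>2 * n ^ 2\<close>; hence the threshold.\<close>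
    case True
    have "a * b \<le> n * n" using a assms by (intro mult_mono) auto
    with aa True have "(0 + 1) * a * b + a * (a + 1) \<le> j * s"
      by (simp add: power2_eq_square)
    moreover have "removed s n 0 (j * s) = replicate_mset j s"
      using assms by (simp add: removed_def)
    ultimately show ?thesis
      using that[of 0 "j * s"] by (simp add: j_def flip: count_le_replicate_mset_subset_eq)
  next
    case False
    have split: "N = j * s + (\<Sum>i\<in>set_mset p - {s}. count p i * i)"
    proof -
      have "N = (\<Sum>i\<in>insert s (set_mset p). count p i * i)"
        using assms by (subst sum_mset_eq_sum_count[symmetric]) auto
      then show ?thesis by (simp add: sum.insert_remove j_def)
    qed
    have "\<exists>i\<in>set_mset p - {s}. 2 * n ^ 6 \<le> count p i * i"
    proof (rule ccontr)
      assume "\<not> ?thesis"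
      then have "(\<Sum>i\<in>set_mset p - {s}. count p i * i) \<le> of_nat (card (set_mset p - {s})) * (2 * n ^ 6)"
        by (intro sum_bounded_above) (simp add: not_le less_imp_le)
      also have "card (set_mset p - {s}) \<le> card {s + 1..n}"
        using assms(6) by (intro card_mono) force+
      then have "of_nat (card (set_mset p - {s})) * (2 * n ^ 6) \<le> n * (2 * n ^ 6)"
        by (intro mult_right_mono) simp_all
      also have "n * (2 * n ^ 6) = 2 * n ^ 7" by (simp flip: power_Suc)
      finally have "N < 2 * n\<^sup>2 + 2 * n ^ 7" using False split by linarith
      have "n ^ 1 \<le> n ^ 3" using n by (intro power_increasing) simp_all
      with n have "2 \<le> n ^ 3" by simp
      then have "2 * n\<^sup>2 \<le> n ^ 3 * n\<^sup>2" by (rule mult_right_mono) simp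
      then have "2 * n\<^sup>2 \<le> n ^ 5" by (simp flip: power_add)
      with \<open>N < 2 * n\<^sup>2 + 2 * n ^ 7\<close> show False using assms(5) by linarith
    qed
    then obtain i where i: "i \<in># p" "i \<noteq> s" "2 * n ^ 6 \<le> count p i * i" by blast
    with assms have ib: "s < i" "i \<le> n" by force+
    define e where "e = i + (n + 1) * j + 1"
    define w where "w = j * s + count p i * i"
    have dec: "(e - 1) mod (n + 1) = i" "(e - 1) div (n + 1) = j"
      using ib by (simp_all add: e_def del: mult_Suc mult_Suc_right)
    have rem: "removed s n e w = replicate_mset j s + replicate_mset (count p i) i"
      unfolding removed_def dec Let_def using ib by (simp add: e_def w_def)
    have "replicate_mset j s + replicate_mset (count p i) i \<subseteq># p"
      using i by (intro mset_subset_eqI) (simp add: j_def)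
    moreover have "(e + 1) * a * b + a * (a + 1) \<le> w"
    proof -
      \<comment> \<open>This keeps \<open>e\<close> of order \<open>n ^ 3\<close>, so
        \<open>(e + 1) * a * b\<close> has order at most \<open>n ^ 5\<close> and fits below
        \<open>2 * n ^ 6\<close>.\<close>
      have "j < 2 * n\<^sup>2" using False assms(1)
        by (metis One_nat_def Suc_leI le_trans mult.right_neutral mult_le_mono2 not_le)
      then have "(n + 1) * j \<le> (n + 1) * (2 * n\<^sup>2)" by (intro mult_left_mono) auto
      with ib have "e + 1 \<le> n + (n + 1) * (2 * n\<^sup>2) + 2" by (simp add: e_def)
      then have "(e + 1) * a * b \<le> (n + (n + 1) * (2 * n\<^sup>2) + 2) * (n - 1) * n"
        using a assms(4) by (intro mult_mono) auto
      moreover have "(n + (n + 1) * (2 * n\<^sup>2) + 2) * (n - 1) * n + n * n \<le> 2 * n ^ 6"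
      proof -
        have "2 * n\<^sup>2 \<le> n * n\<^sup>2" "n * 1 \<le> n * n\<^sup>2" "3 * 1 \<le> n * n\<^sup>2"
          using n by (intro mult_mono; simp)+
        moreover have "n + (n + 1) * (2 * n\<^sup>2) + 2 = n + 2 * (n * n\<^sup>2) + 2 * n\<^sup>2 + 2"
          by (simp add: algebra_simps)
        ultimately have "n + (n + 1) * (2 * n\<^sup>2) + 2 \<le> 6 * (n * n\<^sup>2)"
          by linarith
        also have "\<dots> = 2 * (3 * (n * n\<^sup>2))" by simp
        also have "\<dots> \<le> 2 * (n * (n * n\<^sup>2))"
          using n by (intro mult_left_mono mult_right_mono) auto
        also have "\<dots> = 2 * n ^ 4" by (simp add: eval_nat_numeral)
        finally have A: "n + (n + 1) * (2 * n\<^sup>2) + 2 \<le> 2 * n ^ 4" .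
        \<comment> \<open>The factor \<open>n - 1\<close> comes from \<open>a + 1 \<le> n\<close>.
          Raising it to \<open>n\<close> gains \<open>2 * n ^ 4 * n\<close>, which absorbs
          \<open>n * n\<close>.\<close>
        have "n ^ 1 \<le> n ^ 4" using n by (intro power_increasing) simp_all
        then have "n \<le> 2 * n ^ 4" by simp
        with A have "(n + (n + 1) * (2 * n\<^sup>2) + 2) * (n - 1) * n + n * n
            \<le> 2 * n ^ 4 * (n - 1) * n + 2 * n ^ 4 * n"
          by (intro add_mono mult_right_mono) auto
        also have "\<dots> = 2 * n ^ 4 * (n - 1 + 1) * n" by (simp only: distrib_left distrib_right mult_1_right)
        also have "n - 1 + 1 = n" using n by simp
        also have "2 * n ^ 4 * n * n = 2 * n ^ 6" by (simp add: eval_nat_numeral algebra_simps)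
        finally show ?thesis .
      qed
      ultimately have "(e + 1) * a * b + a * (a + 1) \<le> 2 * n ^ 6"
        using aa by (meson add_mono le_trans)
      also have "\<dots> \<le> w" using i(3) by (simp only: w_def trans_le_add2)
      finally show ?thesis .
    qed
    moreover have "count (removed s n e w) s = count p s" "sum_mset (removed s n e w) = w"
      using i(2) unfolding rem by (simp_all add: j_def w_def)
    ultimately show ?thesis by (intro that[of e w]) (simp_all only: rem)
  qed
qed

text \<open>Positive parts with sum \<open>N\<close> number at most \<open>N\<close>, so lists of
  bounded length over a finite set represent all these partitions.\<close>

lemma finite_D_parts_sum: "finite {p \<in> D_parts L s. sum_mset p = N}"
proof (rule finite_subset)
  show "{p \<in> D_parts L s. sum_mset p = N} \<subseteq> mset ` {xs. set xs \<subseteq> {..L + s} \<and> length xs \<le> N}"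
  proof
    fix p assume "p \<in> {p \<in> D_parts L s. sum_mset p = N}"
    then have p: "\<forall>i\<in>#p. 1 \<le> i" "set_mset p \<subseteq> {..L + s}" "sum_mset p = N"
      by (auto simp: D_parts_def partitions_def Suc_le_eq)
    obtain xs where xs: "mset xs = p" using ex_mset by blast
    have "(\<Sum>i\<in>#p. 1) \<le> (\<Sum>i\<in>#p. i)"
      using p(1) by (intro sum_mset_mono) simp
    then have "size p \<le> N" using p(3) by (simp only: size_eq_sum_mset multiset.map_ident)
    with xs p(2) have "length xs \<le> N" "set xs \<subseteq> {..L + s}"
      by (metis size_mset, metis set_mset_mset)
    with xs show "p \<in> mset ` {xs. set xs \<subseteq> {..L + s} \<and> length xs \<le> N}" by blast
  qed
  show "finite (mset ` {xs. set xs \<subseteq> {..L + s} \<and> length xs \<le> N})"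
    by (intro finite_imageI finite_lists_length_le) simp
qed

theorem theorem3:
  fixes L s N :: nat and V :: "nat set"
  assumes "L > 0" and "s > 0"
    and "V \<subseteq> {s + 1..L + s}" and "card V \<ge> 2"
    and "N \<ge> 2 * (L + s) ^ 7 + (L + s) ^ 5"
  shows "card {p \<in> I_parts L s V. sum_mset p = N} \<le> card {p \<in> D_parts L s. sum_mset p = N}"
proof -
  obtain a b where ab: "a \<in> V" "b \<in> V" "a < b"
    using assms(4) by (metis card_le_Suc0_iff_eq card.infinite linorder_neqE_nat
        not_less_eq_eq numeral_2_eq_2 zero_less_Suc not_le)
  with assms(3) have bd: "s < a" "b \<le> L + s" by auto
  show ?thesis
  proof (rule card_le_if_inj_on_rel[where r = "exchanged s (L + s) a b"])
    show "finite {p \<in> D_parts L s. sum_mset p = N}" by (rule finite_D_parts_sum)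
  next
    fix p assume "p \<in> {p \<in> I_parts L s V. sum_mset p = N}"
    then have p: "sum_mset p = N" "Min (set_mset p) = s" "\<forall>i\<in>#p. i \<le> L + s"
      by (auto simp: I_parts_def)
    then have sub: "set_mset p \<subseteq> {s..L + s}" by auto
    obtain e w where R: "removed s (L + s) e w \<subseteq># p"
      "count (removed s (L + s) e w) s = count p s"
      "sum_mset (removed s (L + s) e w) = w" "(e + 1) * a * b + a * (a + 1) \<le> w"
      using removed_exists[OF assms(2) bd(1) ab(3) bd(2) assms(5) sub p(1)] by metis
    obtain x y where xy: "y div a = e" "sum_mset (refill a b x y) = w"
      using refill_exists[OF _ ab(3) R(4)] bd by (metis less_nat_zero_code neq0_conv)
    define q where "q = p - removed s (L + s) e w + refill a b x y"
    have exch: "exchanged s (L + s) a b p q"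
      unfolding exchanged_def Let_def using R(1) xy q_def by blast
    have sumq: "sum_mset q = N"
      using R(1,3) xy p(1) unfolding q_def
      by (metis sum_mset.union subset_mset.diff_add)
    \<comment> \<open>The part \<open>a + 1\<close> stays in range because
      \<open>a < b\<close>.\<close>
    have refill_sub: "set_mset (refill a b x y) \<subseteq> {s + 1..L + s}"
      using bd ab by (auto simp: refill_def split: if_splits)
    have "s \<notin># p - removed s (L + s) e w"
      using R(2) by (simp add: not_in_iff)
    moreover have "set_mset (p - removed s (L + s) e w) \<subseteq> {s..L + s}"
      using sub by (meson in_diffD subset_iff)
    moreover have "{s + 1..L + s} = {s..L + s} - {s}" by auto
    ultimately have "set_mset (p - removed s (L + s) e w) \<subseteq> {s + 1..L + s}" by blast
    with refill_sub have "set_mset q \<subseteq> {s + 1..L + s}" by (auto simp: q_def)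
    moreover have "q \<noteq> {#}" using sumq assms by auto
    ultimately show "\<exists>q. q \<in> {p \<in> D_parts L s. sum_mset p = N} \<and> exchanged s (L + s) a b p q"
      using sumq exch by (intro exI[of _ q] CollectI conjI) (auto simp: D_parts_def partitions_def)
  next
    fix p p' q
    assume "p \<in> {p \<in> I_parts L s V. sum_mset p = N}" "p' \<in> {p \<in> I_parts L s V. sum_mset p = N}"
      and "exchanged s (L + s) a b p q" "exchanged s (L + s) a b p' q"
    with ab bd show "p = p'"
      by (intro exchanged_inj[of a b p p' s "L + s" q]) (auto simp: I_parts_def)
  qed
qed

end
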